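(* Let $E=E(\mathbf{n},\mathbf{c})$ be a uniform Cantor set. Let $\mathbb{P}$ be an $\mathbf{n}$-matching sequence of positive probability vectors and let $\mu_{\mathbb{P}}$ be the measure on $E$ determined by $\mathbb{P}$. If $\mathbb{P}$ is ultimately $1$-uniform, then $\mu_{\mathbb{P}}$ is doubling on $E$.
   Context: Uniform Cantor set: let $\mathbf{n}=\{n_k\}_{k\ge1}$ be integers with $n_k\geq 2$ and $\mathbf{c}=\{c_k\}_{k\ge1}$ real numbers in $(0,1)$ with $(n_k-1)c_k<1$ for all $k$. Put $E_0=[0,1]$; $E_k$ is obtained from $E_{k-1}$ by deleting from every component $I$ of $E_{k-1}$ exactly $n_k-1$ open intervals, each of length $c_k|I|$, such that the remaining $n_k$ closed intervals are of equal length. Then $E(\mathbf{n},\mathbf{c})=\bigcap_{k\ge 0}E_k$, with the metric inherited from $\mathbb{R}$. Components of $E_k$ are called components of level $k$. Words: $W_k=\{i_1\cdots i_k:1\le i_j\le n_j\}$, $W_0=\{\text{empty word}\}$, and $I_{\text{empty}}=[0,1]$. Inductively, for $w\in W_{k-1}$, $I_{w1},\dots,I_{wn_k}$ denote from left to right the $n_k$ components of level $k$ contained in $I_w$. A vector is a positive probability vector if its entries are all positive and sum to $1$. A positive probability vector $P=(p_1,\dots,p_q)$ is $C$-uniform ($C\ge1$) if $C^{-1}\le\frac{p_{i+1}+\cdots+p_{i+l}}{p_{j+1}+\cdots+p_{j+l}}\le C$ for all integers $i,j,l$ with $l\ge1$ and $0\le i\le j\le i+l\le j+l\le q$; in particular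 $P$ is $1$-uniform if and only if $p_1=\cdots=p_q$. A sequence $\{P_k\}$ is ultimately $C$-uniform if there is an integer $k_0\ge1$ such that $P_k$ is $C$-uniform for each $k\ge k_0$. A sequence $\mathbb{P}=\{P_k\}_{k\ge1}$ of positive probability vectors is $\mathbf{n}$-matching if $P_k=(p_{k,1},\dots,p_{k,n_k})$ has $n_k$ entries for each $k$. Then $\mu_{\mathbb{P}}$ is the unique Borel probability measure on $E(\mathbf{n},\mathbf{c})$ with $\mu_{\mathbb{P}}(I_{wi})=p_{k,i}\,\mu_{\mathbb{P}}(I_w)$ for all $k\ge1$, $w\in W_{k-1}$, $1\le i\le n_k$ (where $\mu_{\mathbb{P}}(I)$ means $\mu_{\mathbb{P}}(I\cap E)$). A Borel regular measure $\mu$ on a metric space $X$ is doubling if there is a constant $C\ge1$ with $0<\mu(B(x,2r))\le C\mu(B(x,r))<\infty$ for all $x\in X$ and $r>0$. *)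

theory Defs
  imports "HOL-Probability.Probability"
begin

text \<open>All sequences are indexed by \<open>k \<ge> 1\<close>; their value at \<open>0\<close> is never used. A vector
  \<open>(p\<^sub>1, \<dots>, p\<^sub>q)\<close> is the list with the elements \<open>p ! 0, \<dots>, p ! (q - 1)\<close>.\<close>

definition uniform_cantor_data :: "(nat \<Rightarrow> nat) \<Rightarrow> (nat \<Rightarrow> real) \<Rightarrow> bool" where
  "uniform_cantor_data n c \<longleftrightarrow>
     (\<forall>k\<ge>1. n k \<ge> 2 \<and> 0 < c k \<and> c k < 1 \<and> (real (n k) - 1) * c k < 1)"

text \<open>If \<open>m - 1\<close> open intervals of length \<open>d * \<bar>I\<bar>\<close> are deleted from the closed interval \<open>I\<close> so that
  \<open>m\<close> closed intervals of one common length remain, that length is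
  \<open>(1 - (m - 1) * d) / m * \<bar>I\<bar>\<close>, which forces the position of the \<open>j\<close>-th deleted interval
  (\<open>1 \<le> j \<le> m - 1\<close>).\<close>

definition ilen :: "real set \<Rightarrow> real" where
  "ilen I = Sup I - Inf I"

definition child_length :: "nat \<Rightarrow> real \<Rightarrow> real set \<Rightarrow> real" where
  "child_length m d I = (1 - (real m - 1) * d) / real m * ilen I"

definition gap :: "nat \<Rightarrow> real \<Rightarrow> real set \<Rightarrow> nat \<Rightarrow> real set" where
  "gap m d I j =
     {Inf I + real j * child_length m d I + (real j - 1) * (d * ilen I) <..<
      Inf I + real j * child_length m d I + real j * (d * ilen I)}"

primrec cantor_level :: "(nat \<Rightarrow> nat) \<Rightarrow> (nat \<Rightarrow> real) \<Rightarrow> nat \<Rightarrow> real set" where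
  "cantor_level n c 0 = {0..1}"
| "cantor_level n c (Suc k) = cantor_level n c k -
     (\<Union>I\<in>components (cantor_level n c k). \<Union>j\<in>{1..n (Suc k) - 1}. gap (n (Suc k)) (c (Suc k)) I j)"

definition uniform_cantor_set :: "(nat \<Rightarrow> nat) \<Rightarrow> (nat \<Rightarrow> real) \<Rightarrow> real set" where
  "uniform_cantor_set n c = (\<Inter>k. cantor_level n c k)"

definition words :: "(nat \<Rightarrow> nat) \<Rightarrow> nat \<Rightarrow> nat list set" where
  "words n k = {w. length w = k \<and> (\<forall>j<k. 1 \<le> w ! j \<and> w ! j \<le> n (Suc j))}"

text \<open>The \<open>i\<close>-th member, counted from left to right starting with \<open>1\<close>, of a finite family of
  disjoint intervals: the one for which exactly \<open>i\<close> members, itself included, do not start to the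
  right of it.\<close>

definition ith_from_left :: "real set set \<Rightarrow> nat \<Rightarrow> real set" where
  "ith_from_left S i = (THE J. J \<in> S \<and> card {K \<in> S. Inf K \<le> Inf J} = i)"

fun cantor_interval :: "(nat \<Rightarrow> nat) \<Rightarrow> (nat \<Rightarrow> real) \<Rightarrow> nat list \<Rightarrow> real set" where
  "cantor_interval n c w =
     (if w = [] then {0..1}
      else ith_from_left
        {J \<in> components (cantor_level n c (length w)). J \<subseteq> cantor_interval n c (butlast w)} (last w))"

declare cantor_interval.simps [simp del]

definition positive_prob_vector :: "real list \<Rightarrow> bool" where
  "positive_prob_vector p \<longleftrightarrow> (\<forall>x\<in>set p. 0 < x) \<and> sum_list p = 1"

text \<open>The sum \<open>\<Sum>t<l. p ! (i + t)\<close> is \<open>p\<^sub>i\<^sub>+\<^sub>1 + \<dots> + p\<^sub>i\<^sub>+\<^sub>l\<close>.\<close>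

definition uniform_vector :: "real \<Rightarrow> real list \<Rightarrow> bool" where
  "uniform_vector C p \<longleftrightarrow>
     (\<forall>i j l. 1 \<le> l \<and> i \<le> j \<and> j \<le> i + l \<and> j + l \<le> length p \<longrightarrow>
        inverse C \<le> (\<Sum>t<l. p ! (i + t)) / (\<Sum>t<l. p ! (j + t)) \<and>
        (\<Sum>t<l. p ! (i + t)) / (\<Sum>t<l. p ! (j + t)) \<le> C)"

definition ultimately_uniform :: "real \<Rightarrow> (nat \<Rightarrow> real list) \<Rightarrow> bool" where
  "ultimately_uniform C P \<longleftrightarrow> (\<exists>k0\<ge>1. \<forall>k\<ge>k0. uniform_vector C (P k))"

definition matching :: "(nat \<Rightarrow> nat) \<Rightarrow> (nat \<Rightarrow> real list) \<Rightarrow> bool" where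
  "matching n P \<longleftrightarrow> (\<forall>k\<ge>1. length (P k) = n k)"

text \<open>There is exactly one such measure, \<open>\<mu>\<^sub>P\<close>. The mass of \<open>[0, 1]\<close>, the interval of the empty word,
  is \<open>1\<close> because the measure is a probability measure.\<close>

definition is_cantor_measure ::
  "(nat \<Rightarrow> nat) \<Rightarrow> (nat \<Rightarrow> real) \<Rightarrow> (nat \<Rightarrow> real list) \<Rightarrow> real measure \<Rightarrow> bool" where
  "is_cantor_measure n c P \<mu> \<longleftrightarrow>
     prob_space \<mu> \<and>
     space \<mu> = uniform_cantor_set n c \<and>
     sets \<mu> = sets (restrict_space borel (uniform_cantor_set n c)) \<and>
     (\<forall>k\<ge>1. \<forall>w\<in>words n (k - 1). \<forall>i\<in>{1..n k}.
        measure \<mu> (cantor_interval n c (w @ [i]) \<inter> uniform_cantor_set n c) =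
        P k ! (i - 1) * measure \<mu> (cantor_interval n c w \<inter> uniform_cantor_set n c))"

text \<open>Borel regularity is a property of the outer measure induced by \<open>\<mu>\<close>: Borel sets are measurable
  and each subset of \<open>X\<close> lies in a Borel set of the same outer measure.\<close>

definition borel_regular_on :: "'a::metric_space set \<Rightarrow> 'a measure \<Rightarrow> bool" where
  "borel_regular_on X \<mu> \<longleftrightarrow>
     space \<mu> = X \<and> sets (restrict_space borel X) \<subseteq> sets \<mu> \<and>
     (\<forall>A\<subseteq>X. \<exists>B\<in>sets (restrict_space borel X).
        A \<subseteq> B \<and> outer_measure_of \<mu> A = outer_measure_of \<mu> B)"

text \<open>The balls of the subspace \<open>X\<close> are the traces on \<open>X\<close> of the balls of the ambient space.\<close>

definition doubling_on :: "'a::metric_space set \<Rightarrow> 'a measure \<Rightarrow> bool" where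
  "doubling_on X \<mu> \<longleftrightarrow>
     borel_regular_on X \<mu> \<and>
     (\<exists>C::real\<ge>1. \<forall>x\<in>X. \<forall>r>0.
        0 < emeasure \<mu> (ball x (2 * r) \<inter> X) \<and>
        emeasure \<mu> (ball x (2 * r) \<inter> X) \<le> ennreal C * emeasure \<mu> (ball x r \<inter> X) \<and>
        ennreal C * emeasure \<mu> (ball x r \<inter> X) < \<infinity>)"

end

theory Submission
  imports Defs
begin

text \<open>
  Write \<open>L k\<close> for the length of the components of level \<open>k\<close> and \<open>s k\<close> for the distance between the
  left ends of neighbouring children of a component of level \<open>k\<close>. Both depend on the level only, so
  a ball is compared with its double by counting components, once the masses of the components of
  each level agree up to a factor \<open>A\<close> that does not depend on the level.

  Such an \<open>A\<close> exists: \<open>1\<close>-uniformity makes all entries of \<open>P k\<close> equal, so from some level on every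
  component divides its mass equally among its children and the ratios between masses stay what they
  were. Only finitely many components come before that level, and all of them have positive mass.

  For the counting, let \<open>x \<in> E\<close> and \<open>0 < r \<le> 1\<close>. Choose \<open>k\<close> with \<open>L (k + 1) < r \<le> L k\<close> and
  \<open>m \<ge> 0\<close> with \<open>m s < r - L (k + 1) \<le> (m + 1) s\<close>, where \<open>s = s k\<close>. The component of level \<open>k + 1\<close> around
  \<open>x\<close> has at least \<open>m + 1\<close> siblings, itself included, at most \<open>m\<close> places away, and all of them lie in
  the ball of radius \<open>r\<close> (\<open>card_neighbours\<close>, \<open>sibling_in_ball\<close>). On the other hand the doubled ball
  meets at most \<open>6\<close> components of level \<open>k\<close> and at most \<open>4 m + 10\<close> children of each, because left ends
  are separated by \<open>L k\<close> and \<open>s\<close> respectively (\<open>card_meeting_ball\<close>). Together this gives the doubling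
  constant \<open>60 A\<^sup>2\<close> (\<open>doubling_on_if_masses_comparable\<close>); a ball of radius greater than \<open>1\<close> contains \<open>E\<close>.

  To count, the components must be known explicitly. The given definition finds them as connected
  components and orders them by their left ends; \<open>components_cantor_level\<close> and \<open>cantor_interval_eq\<close>
  identify them with intervals whose left ends are sums over the letters of the word.
\<close>

section \<open>Disjoint closed sets and separated points\<close>

lemma UN_Diff_UN_separate:
  assumes "\<And>v w. w \<in> W \<Longrightarrow> v \<in> W \<Longrightarrow> w \<noteq> v \<Longrightarrow> A w \<inter> G v = {}"
  shows "\<Union>(A ` W) - \<Union>(G ` W) = (\<Union>w\<in>W. A w - G w)"
proof (intro equalityI subsetI)
  fix x assume "x \<in> (\<Union>w\<in>W. A w - G w)"
  then obtain w where w: "w \<in> W" "x \<in> A w" "x \<notin> G w" by blast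
  have "x \<notin> G v" if "v \<in> W" for v
    using assms[OF w(1) that] w by blast
  then show "x \<in> \<Union>(A ` W) - \<Union>(G ` W)" using w by blast
qed blast

text \<open>Each member of a finite disjoint family of closed sets is relatively clopen in the union, so a
  connected subset of the union cannot leave it.\<close>

lemma components_finite_disjoint_Union:
  fixes F :: "'a::topological_space set set"
  assumes "finite F" "disjoint F"
    and F: "\<And>S. S \<in> F \<Longrightarrow> closed S \<and> connected S \<and> S \<noteq> {}"
  shows "components (\<Union>F) = F"
proof -
  have comp: "connected_component_set (\<Union>F) x = S" if "S \<in> F" "x \<in> S" for S x
  proof
    show "S \<subseteq> connected_component_set (\<Union>F) x"
      using that F by (intro connected_component_maximal) auto
    let ?T = "connected_component_set (\<Union>F) x" and ?R = "\<Union>(F - {S})"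
    have "closed ?R" using \<open>finite F\<close> F by (intro closed_Union) auto
    moreover have "S \<inter> ?R = {}"
      using \<open>disjoint F\<close> \<open>S \<in> F\<close> by (auto simp: disjoint_def)
    moreover have "?T \<subseteq> S \<union> ?R"
      using connected_component_subset[of "\<Union>F" x] by auto
    moreover have "x \<in> S \<inter> ?T" using that by auto
    ultimately have "?R \<inter> ?T = {}"
      using connected_closedD[OF connected_connected_component[of "\<Union>F" x], of S ?R] F that
      by blast
    then show "?T \<subseteq> S" using \<open>?T \<subseteq> S \<union> ?R\<close> by blast
  qed
  have "components (\<Union>F) = (\<Union>S\<in>F. connected_component_set (\<Union>F) ` S)"
    by (auto simp: components_def)
  also have "\<dots> = (\<Union>S\<in>F. {S})"
  proof (intro SUP_cong refl)
    fix S assume "S \<in> F"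
    then show "connected_component_set (\<Union>F) ` S = {S}"
      using comp F[of S] by (auto simp: image_iff)
  qed
  finally show ?thesis by simp
qed

text \<open>Dividing \<open>[a, b]\<close> into cells of length \<open>d\<close>, no cell contains two of the points.\<close>

lemma card_separated_le:
  fixes f :: "'a \<Rightarrow> real"
  assumes "0 < d"
    and range: "\<And>u. u \<in> W \<Longrightarrow> f u \<in> {a..b}"
    and sep: "\<And>u v. u \<in> W \<Longrightarrow> v \<in> W \<Longrightarrow> u \<noteq> v \<Longrightarrow> d \<le> \<bar>f u - f v\<bar>"
    and "a \<le> b"
  shows "finite W" "real (card W) \<le> (b - a) / d + 1"
proof -
  define g where "g u = nat \<lfloor>(f u - a) / d\<rfloor>" for u
  let ?T = "{..nat \<lfloor>(b - a) / d\<rfloor>}"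
  have inj: "inj_on g W"
  proof (intro inj_onI, rule ccontr)
    fix u v assume uv: "u \<in> W" "v \<in> W" "g u = g v" "u \<noteq> v"
    have "0 \<le> (f u - a) / d" "0 \<le> (f v - a) / d"
      using range[OF uv(1)] range[OF uv(2)] \<open>0 < d\<close> by auto
    then have "\<bar>(f u - a) / d - (f v - a) / d\<bar> < 1"
      using uv(3) unfolding g_def by linarith
    then have "\<bar>(f u - f v) / d\<bar> < 1" by (simp add: diff_divide_distrib)
    then have "\<bar>f u - f v\<bar> < d" using \<open>0 < d\<close> by (simp add: abs_divide)
    then show False using sep[OF uv(1,2,4)] by simp
  qed
  have img: "g ` W \<subseteq> ?T"
  proof (rule image_subsetI)
    fix u assume "u \<in> W"
    then have "(f u - a) / d \<le> (b - a) / d"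
      using range[of u] \<open>0 < d\<close> by (intro divide_right_mono) auto
    then show "g u \<in> ?T" unfolding g_def by (simp add: floor_mono nat_mono)
  qed
  show "finite W" using inj img inj_on_finite by blast
  have "card W \<le> card ?T" using inj img by (intro card_inj_on_le) auto
  moreover have "0 \<le> (b - a) / d" using assms by simp
  ultimately show "real (card W) \<le> (b - a) / d + 1" by simp linarith
qed

text \<open>If fewer than \<open>m\<close> indices precede \<open>i\<close>, the first \<open>m + 1\<close> indices all qualify; otherwise \<open>i\<close>
  and its \<open>m\<close> predecessors do. This is why a centre close to the end of its parent interval does no
  harm.\<close>

lemma card_neighbours:
  fixes i m N :: nat
  assumes "i \<in> {1..N}" "m < N"
  shows "m + 1 \<le> card {j \<in> {1..N}. \<bar>real j - real i\<bar> \<le> real m}"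
proof -
  let ?T = "{j \<in> {1..N}. \<bar>real j - real i\<bar> \<le> real m}"
  have "\<exists>A \<subseteq> ?T. card A = m + 1"
  proof (cases "i \<le> m")
    case True
    then have "{1..m + 1} \<subseteq> ?T" using assms by auto
    then show ?thesis by (intro exI[of _ "{1..m + 1}"]) auto
  next
    case False
    then have "{i - m..i} \<subseteq> ?T" using assms by auto
    then show ?thesis using False by (intro exI[of _ "{i - m..i}"]) auto
  qed
  then obtain A where "A \<subseteq> ?T" "card A = m + 1" by blast
  moreover have "finite ?T" by simp
  ultimately show ?thesis using card_mono by metis
qed

section \<open>The components in closed form\<close>

primrec level_length :: "(nat \<Rightarrow> nat) \<Rightarrow> (nat \<Rightarrow> real) \<Rightarrow> nat \<Rightarrow> real" where
  "level_length n c 0 = 1"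
| "level_length n c (Suc k) =
     (1 - (real (n (Suc k)) - 1) * c (Suc k)) / real (n (Suc k)) * level_length n c k"

\<comment> \<open>Consecutive lengths are compared through the additive identity \<open>L_decompose\<close>; expanding the quotient
  would hide it.\<close>
declare level_length.simps(2) [simp del]

definition level_step :: "(nat \<Rightarrow> nat) \<Rightarrow> (nat \<Rightarrow> real) \<Rightarrow> nat \<Rightarrow> real" where
  "level_step n c k = level_length n c (Suc k) + c (Suc k) * level_length n c k"

text \<open>The children of a component are equally spaced, so each letter contributes an independent
  offset and the order of the letters enters only through their levels.\<close>

definition left_end :: "(nat \<Rightarrow> nat) \<Rightarrow> (nat \<Rightarrow> real) \<Rightarrow> nat list \<Rightarrow> real" where
  "left_end n c w = (\<Sum>j<length w. (real (w ! j) - 1) * level_step n c j)"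

definition word_interval :: "(nat \<Rightarrow> nat) \<Rightarrow> (nat \<Rightarrow> real) \<Rightarrow> nat list \<Rightarrow> real set" where
  "word_interval n c w = {left_end n c w .. left_end n c w + level_length n c (length w)}"

lemma words_0: "words n 0 = {[]}"
  by (auto simp: words_def)

lemma words_length: "w \<in> words n k \<Longrightarrow> length w = k"
  by (simp add: words_def)

lemma words_snoc_iff:
  "w @ [i] \<in> words n (Suc k) \<longleftrightarrow> w \<in> words n k \<and> i \<in> {1..n (Suc k)}"
  by (auto simp: words_def nth_append less_Suc_eq)

lemma words_SucE:
  assumes "w \<in> words n (Suc k)"
  obtains u i where "w = u @ [i]" "u \<in> words n k" "i \<in> {1..n (Suc k)}"
proof -
  have "w \<noteq> []" using assms by (auto simp: words_def)
  then have "w = butlast w @ [last w]" by simp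
  then show thesis using that assms words_snoc_iff by metis
qed

lemma words_Suc: "words n (Suc k) = (\<lambda>(u, i). u @ [i]) ` (words n k \<times> {1..n (Suc k)})"
  by (auto elim!: words_SucE simp: words_snoc_iff image_iff)

lemma finite_words: "finite (words n k)"
  by (induction k) (simp_all add: words_0 words_Suc)

lemma left_end_Nil [simp]: "left_end n c [] = 0"
  by (simp add: left_end_def)

lemma left_end_snoc [simp]:
  "left_end n c (w @ [i]) = left_end n c w + (real i - 1) * level_step n c (length w)"
  by (simp add: left_end_def nth_append)

locale uniform_cantor =
  fixes n :: "nat \<Rightarrow> nat" and c :: "nat \<Rightarrow> real"
  assumes data: "uniform_cantor_data n c"
begin

abbreviation "L \<equiv> level_length n c"
abbreviation "s \<equiv> level_step n c"
abbreviation "J \<equiv> word_interval n c"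
abbreviation "E \<equiv> uniform_cantor_set n c"

lemma data_Suc:
  "2 \<le> n (Suc k)" "0 < c (Suc k)" "(real (n (Suc k)) - 1) * c (Suc k) < 1"
  using data by (auto simp: uniform_cantor_data_def)

lemma L_pos: "0 < L k"
proof (induction k)
  case (Suc k)
  then show ?case using data_Suc[of k] by (simp add: level_length.simps(2))
qed simp

lemma L_less_s: "L (Suc k) < s k"
  unfolding level_step_def using data_Suc(2)[of k] L_pos[of k] by simp

lemma s_pos: "0 < s k"
  using L_less_s[of k] L_pos[of "Suc k"] by linarith

text \<open>The \<open>n (k + 1)\<close> children of a component fill it from end to end.\<close>

lemma L_decompose: "L k = (real (n (Suc k)) - 1) * s k + L (Suc k)"
proof -
  have "real (n (Suc k)) * L (Suc k) = (1 - (real (n (Suc k)) - 1) * c (Suc k)) * L k"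
    using data_Suc(1)[of k] by (simp add: level_length.simps(2))
  then show ?thesis
    by (simp add: level_step_def algebra_simps)
qed

lemma L_halves: "L (Suc k) \<le> L k / 2"
proof -
  have "1 * s k \<le> (real (n (Suc k)) - 1) * s k"
    using data_Suc(1)[of k] s_pos[of k] by (intro mult_right_mono) auto
  then show ?thesis using L_decompose[of k] L_less_s[of k] by linarith
qed

lemma L_le_power: "L k \<le> (1 / 2) ^ k"
proof (induction k)
  case (Suc k)
  then show ?case using L_halves[of k] by (simp)
qed simp

lemma offset_bounds:
  assumes "i \<in> {1..n (Suc k)}"
  shows "0 \<le> (real i - 1) * s k" "(real i - 1) * s k + L (Suc k) \<le> L k"
proof -
  show "0 \<le> (real i - 1) * s k" using assms s_pos[of k] by auto
  have "(real i - 1) * s k \<le> (real (n (Suc k)) - 1) * s k"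
    using assms s_pos[of k] by (intro mult_right_mono) auto
  then show "(real i - 1) * s k + L (Suc k) \<le> L k" using L_decompose[of k] by linarith
qed

lemma child_interval:
  assumes "w \<in> words n k"
  shows "J (w @ [i]) = {left_end n c w + (real i - 1) * s k ..
                        left_end n c w + (real i - 1) * s k + L (Suc k)}"
  using words_length[OF assms] by (simp add: word_interval_def)

lemma child_subset:
  assumes "w \<in> words n k" "i \<in> {1..n (Suc k)}"
  shows "J (w @ [i]) \<subseteq> J w"
  unfolding child_interval[OF assms(1)]
  using offset_bounds[OF assms(2)] words_length[OF assms(1)]
  by (auto simp: word_interval_def)

lemma left_end_siblings:
  assumes "i \<noteq> j"
  shows "s k \<le> \<bar>(real i - 1) * s k - (real j - 1) * s k\<bar>"
proof -
  have "1 * s k \<le> \<bar>real i - real j\<bar> * s k"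
    using assms s_pos[of k] by (intro mult_right_mono) auto
  also have "\<dots> = \<bar>(real i - real j) * s k\<bar>" using s_pos[of k] by (simp add: abs_mult)
  also have "\<dots> = \<bar>(real i - 1) * s k - (real j - 1) * s k\<bar>" by (simp add: algebra_simps)
  finally show ?thesis by simp
qed

text \<open>Words with different parents inherit the separation of the parents, reduced by at most the
  largest offset of a child, which is \<open>L k - L (k + 1)\<close>.\<close>

lemma left_end_separated:
  assumes "u \<in> words n k" "v \<in> words n k" "u \<noteq> v"
  shows "L k < \<bar>left_end n c u - left_end n c v\<bar>"
  using assms
proof (induction k arbitrary: u v)
  case 0
  then show ?case by (simp add: words_0)
next
  case (Suc k)
  obtain u' i where u: "u = u' @ [i]" "u' \<in> words n k" "i \<in> {1..n (Suc k)}"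
    using Suc.prems(1) by (rule words_SucE)
  obtain v' j where v: "v = v' @ [j]" "v' \<in> words n k" "j \<in> {1..n (Suc k)}"
    using Suc.prems(2) by (rule words_SucE)
  have len: "length u' = k" "length v' = k" using u v words_length by auto
  show ?case
  proof (cases "u' = v'")
    case True
    then have "i \<noteq> j" using Suc.prems u v by auto
    then show ?thesis
      using left_end_siblings[of i j k] L_less_s[of k] True by (simp add: u v len)
  next
    case False
    then have "L k < \<bar>left_end n c u' - left_end n c v'\<bar>" using Suc.IH u v by blast
    then show ?thesis
      using offset_bounds[OF u(3)] offset_bounds[OF v(3)]
      by (simp add: u(1) v(1) len)
  qed
qed

lemma word_intervals_disjoint:
  assumes "u \<in> words n k" "v \<in> words n k" "u \<noteq> v"
  shows "J u \<inter> J v = {}"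
  using left_end_separated[OF assms] words_length[OF assms(1)] words_length[OF assms(2)]
  by (auto simp: word_interval_def)

lemma word_interval_nonempty: "J w \<noteq> {}"
  using L_pos[of "length w"] by (simp add: word_interval_def)

lemma gap_word_interval:
  assumes "w \<in> words n k"
  shows "gap (n (Suc k)) (c (Suc k)) (J w) j =
    {left_end n c w + (real j - 1) * s k + L (Suc k) <..< left_end n c w + real j * s k}"
proof -
  have "Inf (J w) = left_end n c w" "ilen (J w) = L k"
    using L_pos[of k] words_length[OF assms] by (simp_all add: word_interval_def ilen_def)
  moreover from this have "child_length (n (Suc k)) (c (Suc k)) (J w) = L (Suc k)"
    by (simp add: child_length_def level_length.simps(2))
  ultimately show ?thesis
    unfolding gap_def level_step_def by (simp add: algebra_simps)
qed

lemma gap_subset: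
  assumes "w \<in> words n k" "j \<in> {1..n (Suc k) - 1}"
  shows "gap (n (Suc k)) (c (Suc k)) (J w) j \<subseteq> J w"
proof -
  have "real j * s k \<le> (real (n (Suc k)) - 1) * s k"
    using assms(2) data_Suc(1)[of k] s_pos[of k] by (intro mult_right_mono) auto
  moreover have "0 \<le> (real j - 1) * s k" using assms(2) s_pos[of k] by auto
  ultimately show ?thesis
    unfolding gap_word_interval[OF assms(1)]
    using L_decompose[of k] L_pos[of "Suc k"] words_length[OF assms(1)]
    by (auto simp: word_interval_def)
qed

text \<open>The spacing \<open>s k\<close> cuts the interval into cells, each of which is a child followed by a gap; the
  last cell is cut off after its child.\<close>

lemma remove_gaps:
  assumes "w \<in> words n k"
  shows "J w - (\<Union>j\<in>{1..n (Suc k) - 1}. gap (n (Suc k)) (c (Suc k)) (J w) j)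
       = (\<Union>i\<in>{1..n (Suc k)}. J (w @ [i]))" (is "?lhs = ?rhs")
proof
  let ?a = "left_end n c w" and ?N = "n (Suc k)"
  show "?lhs \<subseteq> ?rhs"
  proof
    fix x assume x: "x \<in> ?lhs"
    then have x1: "?a \<le> x" "x \<le> ?a + L k"
      using words_length[OF assms] by (auto simp: word_interval_def)
    \<comment> \<open>the cell of \<open>x\<close>; cells are counted from \<open>0\<close>, children and gaps from \<open>1\<close>\<close>
    define q where "q = nat \<lfloor>(x - ?a) / s k\<rfloor>"
    have "0 \<le> (x - ?a) / s k" using x1 s_pos[of k] by simp
    then have "real q \<le> (x - ?a) / s k" "(x - ?a) / s k < real q + 1"
      unfolding q_def by linarith+
    then have q: "real q * s k \<le> x - ?a" "x - ?a < (real q + 1) * s k"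
      using s_pos[of k] by (simp_all add: field_simps)
    have "real q * s k < (real ?N - 1) * s k + s k"
      using q(1) x1(2) L_decompose[of k] L_less_s[of k] by linarith
    then have "real q * s k < real ?N * s k" by (simp add: algebra_simps)
    then have "q < ?N" using s_pos[of k] by simp
    have "x \<le> ?a + real q * s k + L (Suc k)"
    proof (cases "Suc q = ?N")
      case True
      then have "real q = real ?N - 1" by linarith
      then show ?thesis using x1(2) L_decompose[of k] by simp
    next
      case False
      then have "Suc q \<in> {1..?N - 1}" using \<open>q < ?N\<close> by auto
      then have "x \<notin> gap ?N (c (Suc k)) (J w) (Suc q)" using x by blast
      then show ?thesis using q unfolding gap_word_interval[OF assms]
        by (auto simp: algebra_simps)
    qed
    then have "x \<in> J (w @ [Suc q])"
      unfolding child_interval[OF assms] using q by simp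
    then show "x \<in> ?rhs" using \<open>q < ?N\<close> by force
  qed
  show "?rhs \<subseteq> ?lhs"
  proof
    fix x assume "x \<in> ?rhs"
    then obtain i where i: "i \<in> {1..?N}" "x \<in> J (w @ [i])" by blast
    then have xi: "?a + (real i - 1) * s k \<le> x" "x \<le> ?a + (real i - 1) * s k + L (Suc k)"
      unfolding child_interval[OF assms] by auto
    have "x \<notin> gap ?N (c (Suc k)) (J w) j" for j
    proof (cases "j < i")
      case True
      then have "real j * s k \<le> (real i - 1) * s k"
        using s_pos[of k] by (intro mult_right_mono) auto
      then show ?thesis unfolding gap_word_interval[OF assms] using xi by auto
    next
      case False
      then have "(real i - 1) * s k \<le> (real j - 1) * s k"
        using s_pos[of k] by (intro mult_right_mono) auto
      then show ?thesis unfolding gap_word_interval[OF assms] using xi by auto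
    qed
    moreover have "x \<in> J w" using i child_subset[OF assms] by blast
    ultimately show "x \<in> ?lhs" by blast
  qed
qed

text \<open>The construction removes gaps from the components of the previous level, so the closed form of a
  level depends on knowing the components of the level before it. They are known as soon as that
  level is a finite disjoint union of word intervals, hence the two facts are proved together.\<close>

lemma cantor_level_eq: "cantor_level n c k = \<Union>(J ` words n k)"
  and components_cantor_level: "components (cantor_level n c k) = J ` words n k"
proof -
  have comps: "components (\<Union>(J ` words n k)) = J ` words n k" for k
  proof (rule components_finite_disjoint_Union)
    show "finite (J ` words n k)" by (simp add: finite_words)
    show "disjoint (J ` words n k)"
      unfolding disjoint_def using word_intervals_disjoint by blast
    show "closed S \<and> connected S \<and> S \<noteq> {}" if "S \<in> J ` words n k" for S
      using that word_interval_nonempty by (auto simp: word_interval_def)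
  qed
  show level: "cantor_level n c k = \<Union>(J ` words n k)"
  proof (induction k)
    case 0
    then show ?case by (simp add: words_0 word_interval_def)
  next
    case (Suc k)
    let ?G = "\<lambda>w. \<Union>j\<in>{1..n (Suc k) - 1}. gap (n (Suc k)) (c (Suc k)) (J w) j"
    have sub: "?G w \<subseteq> J w" if "w \<in> words n k" for w using gap_subset[OF that] by blast
    have "cantor_level n c (Suc k) = \<Union>(J ` words n k) - (\<Union>w\<in>words n k. ?G w)"
      by (simp add: Suc.IH comps)
    also have "\<dots> = (\<Union>w\<in>words n k. J w - ?G w)"
    proof (rule UN_Diff_UN_separate)
      show "J w \<inter> ?G v = {}" if "w \<in> words n k" "v \<in> words n k" "w \<noteq> v" for v w
        using sub[OF that(2)] word_intervals_disjoint[OF that] by blast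
    qed
    also have "\<dots> = (\<Union>w\<in>words n k. \<Union>i\<in>{1..n (Suc k)}. J (w @ [i]))"
      by (intro SUP_cong refl remove_gaps)
    also have "\<dots> = \<Union>(J ` words n (Suc k))" by (force simp: words_Suc)
    finally show ?case .
  qed
  show "components (cantor_level n c k) = J ` words n k"
    unfolding level by (rule comps)
qed

lemma word_interval_subset_iff:
  assumes "w \<in> words n k" "v \<in> words n (Suc k)"
  shows "J v \<subseteq> J w \<longleftrightarrow> (\<exists>i\<in>{1..n (Suc k)}. v = w @ [i])"
proof
  assume sub: "J v \<subseteq> J w"
  obtain u i where v: "v = u @ [i]" "u \<in> words n k" "i \<in> {1..n (Suc k)}"
    using assms(2) by (rule words_SucE)
  have "J v \<subseteq> J u" using v child_subset by blast
  then have "u = w"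
    using sub word_interval_nonempty[of v] word_intervals_disjoint[OF v(2) assms(1)] by blast
  then show "\<exists>i\<in>{1..n (Suc k)}. v = w @ [i]" using v by blast
qed (use assms child_subset in blast)

text \<open>The number of children that do not start to the right of the \<open>j\<close>-th one is \<open>j\<close>, so this number
  determines the child.\<close>

lemma ith_child:
  assumes w: "w \<in> words n k" and i: "i \<in> {1..n (Suc k)}"
  shows "ith_from_left ((\<lambda>j. J (w @ [j])) ` {1..n (Suc k)}) i = J (w @ [i])"
proof -
  let ?S = "(\<lambda>j. J (w @ [j])) ` {1..n (Suc k)}"
  have inf: "Inf (J (w @ [j])) = left_end n c w + (real j - 1) * s k" for j
    unfolding child_interval[OF w] using L_pos[of "Suc k"] by simp
  have le: "Inf (J (w @ [j])) \<le> Inf (J (w @ [j'])) \<longleftrightarrow> j \<le> j'" for j j'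
    unfolding inf using s_pos[of k] by simp
  have inj: "inj_on (\<lambda>j. J (w @ [j])) A" for A
    using le by (intro inj_onI) (metis order.antisym order.refl)
  have rank: "card {K \<in> ?S. Inf K \<le> Inf (J (w @ [j]))} = j" if "j \<in> {1..n (Suc k)}" for j
  proof -
    have "{K \<in> ?S. Inf K \<le> Inf (J (w @ [j]))} = (\<lambda>j. J (w @ [j])) ` {1..j}"
      using that by (auto simp: le)
    then show ?thesis by (simp add: card_image[OF inj])
  qed
  show ?thesis
    unfolding ith_from_left_def
  proof (rule the_equality)
    show "J (w @ [i]) \<in> ?S \<and> card {K \<in> ?S. Inf K \<le> Inf (J (w @ [i]))} = i"
      using i rank by blast
    show "K = J (w @ [i])" if K: "K \<in> ?S \<and> card {K' \<in> ?S. Inf K' \<le> Inf K} = i" for K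
    proof -
      obtain j where j: "j \<in> {1..n (Suc k)}" "K = J (w @ [j])" using K by blast
      then show ?thesis using K rank[OF j(1)] by metis
    qed
  qed
qed

lemma cantor_interval_eq: "w \<in> words n k \<Longrightarrow> cantor_interval n c w = J w"
proof (induction k arbitrary: w)
  case 0
  then show ?case by (simp add: words_0 cantor_interval.simps word_interval_def)
next
  case (Suc k)
  obtain u i where w: "w = u @ [i]" "u \<in> words n k" "i \<in> {1..n (Suc k)}"
    using Suc.prems by (rule words_SucE)
  have "{K \<in> J ` words n (Suc k). K \<subseteq> J u} = (\<lambda>j. J (u @ [j])) ` {1..n (Suc k)}"
  proof (intro equalityI subsetI)
    fix K assume "K \<in> {K \<in> J ` words n (Suc k). K \<subseteq> J u}"
    then obtain v where "v \<in> words n (Suc k)" "K = J v" "J v \<subseteq> J u" by blast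
    then show "K \<in> (\<lambda>j. J (u @ [j])) ` {1..n (Suc k)}"
      using word_interval_subset_iff[OF w(2)] by blast
  next
    fix K assume "K \<in> (\<lambda>j. J (u @ [j])) ` {1..n (Suc k)}"
    then obtain j where "j \<in> {1..n (Suc k)}" "K = J (u @ [j])" by blast
    then show "K \<in> {K \<in> J ` words n (Suc k). K \<subseteq> J u}"
      using child_subset[OF w(2)] words_snoc_iff w(2) by blast
  qed
  then show ?case
    using ith_child[OF w(2,3)] Suc.IH[OF w(2)] words_length[OF w(2)]
    by (subst cantor_interval.simps) (simp add: w(1) components_cantor_level del: cantor_level.simps)
qed

lemma E_subset: "E \<subseteq> \<Union>(J ` words n k)"
  unfolding uniform_cantor_set_def using cantor_level_eq by blast

lemma E_subset_unit: "E \<subseteq> J []"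
  using E_subset[of 0] by (simp add: words_0)

section \<open>Counting the components near a ball\<close>

text \<open>The first level whose components are shorter than \<open>r\<close> is not level \<open>0\<close>, since \<open>r \<le> L 0 = 1\<close>.\<close>

lemma find_scale:
  assumes "0 < r" "r \<le> 1"
  obtains k where "L (Suc k) < r" "r \<le> L k"
proof -
  obtain j where "(1 / 2) ^ j < r" using real_arch_pow_inv[of r "1/2"] assms by auto
  then have j: "L j < r" using L_le_power[of j] by linarith
  define q where "q = (LEAST j. L j < r)"
  have q: "L q < r" unfolding q_def using j by (rule LeastI)
  have "q \<noteq> 0" using q assms by (cases q) auto
  then obtain k where k: "q = Suc k" by (cases q) auto
  have "\<not> L k < r" using not_less_Least[of k "\<lambda>j. L j < r"] k unfolding q_def by auto
  then show thesis using q k that by auto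
qed

text \<open>Since \<open>r > L (k + 1)\<close>, even \<open>m = 0\<close> satisfies the strict lower bound; the largest such \<open>m\<close> is
  chosen.\<close>

lemma find_multiple:
  assumes "L (Suc k) < r"
  obtains m :: nat where "real m * s k < r - L (Suc k)" "r - L (Suc k) \<le> (real m + 1) * s k"
proof -
  define m where "m = nat (\<lceil>(r - L (Suc k)) / s k\<rceil> - 1)"
  have "0 < (r - L (Suc k)) / s k" using assms s_pos[of k] by simp
  then have "real m < (r - L (Suc k)) / s k" "(r - L (Suc k)) / s k \<le> real m + 1"
    unfolding m_def by linarith+
  then show thesis using that s_pos[of k] by (simp add: field_simps)
qed

lemma sibling_in_ball:
  assumes u: "u \<in> words n k" and x: "x \<in> J (u @ [i])"
    and j: "\<bar>real j - real i\<bar> \<le> real m" and m: "real m * s k < r - L (Suc k)"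
  shows "J (u @ [j]) \<subseteq> ball x r"
proof
  fix y assume "y \<in> J (u @ [j])"
  then have "\<bar>x - y\<bar> \<le> \<bar>(real j - 1) * s k - (real i - 1) * s k\<bar> + L (Suc k)"
    using x unfolding child_interval[OF u] by auto
  also have "(real j - 1) * s k - (real i - 1) * s k = (real j - real i) * s k"
    by (simp add: algebra_simps)
  also have "\<bar>(real j - real i) * s k\<bar> = \<bar>real j - real i\<bar> * s k"
    using s_pos[of k] by (simp add: abs_mult)
  also have "\<bar>real j - real i\<bar> * s k \<le> real m * s k"
    using j s_pos[of k] by (intro mult_right_mono) auto
  finally show "y \<in> ball x r" using m by (simp add: dist_real_def)
qed

text \<open>The left ends of these components lie in an interval of length \<open>4 r + L k \<le> 5 L k\<close> and are
  separated by \<open>L k\<close>.\<close>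

lemma card_parents_meeting_ball:
  assumes "0 < r" "r \<le> L k"
  shows "card {u \<in> words n k. J u \<inter> ball x (2 * r) \<noteq> {}} \<le> 6"
proof -
  let ?U = "{u \<in> words n k. J u \<inter> ball x (2 * r) \<noteq> {}}"
  have "real (card ?U) \<le> (x + 2 * r - (x - 2 * r - L k)) / L k + 1"
  proof (rule card_separated_le(2))
    show "left_end n c u \<in> {x - 2 * r - L k .. x + 2 * r}" if "u \<in> ?U" for u
      using that words_length[of u n k] by (auto simp: word_interval_def dist_real_def)
    show "L k \<le> \<bar>left_end n c u - left_end n c v\<bar>" if "u \<in> ?U" "v \<in> ?U" "u \<noteq> v" for u v
      using that left_end_separated[of u k v] by simp
  qed (use assms L_pos[of k] in auto)
  also have "\<dots> \<le> 6" using assms L_pos[of k] by (simp add: field_simps)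
  finally show ?thesis by simp
qed

text \<open>Here the left ends are separated by \<open>s k\<close> and lie in an interval of length \<open>4 r + L (k + 1)\<close>, which
  is at most \<open>(4 m + 9) s k\<close> by the choice of \<open>m\<close> and \<open>L (k + 1) < s k\<close>.\<close>

lemma card_children_meeting_ball:
  assumes u: "u \<in> words n k" and "0 < r" "r - L (Suc k) \<le> (real m + 1) * s k"
  shows "card {i \<in> {1..n (Suc k)}. J (u @ [i]) \<inter> ball x (2 * r) \<noteq> {}} \<le> 4 * m + 10"
proof -
  let ?I = "{i \<in> {1..n (Suc k)}. J (u @ [i]) \<inter> ball x (2 * r) \<noteq> {}}"
  have "real (card ?I) \<le> (x + 2 * r - (x - 2 * r - L (Suc k))) / s k + 1"
  proof (rule card_separated_le(2))
    show "left_end n c (u @ [i]) \<in> {x - 2 * r - L (Suc k) .. x + 2 * r}" if "i \<in> ?I" for i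
      using that words_length[OF u] unfolding child_interval[OF u]
      by (auto simp: dist_real_def)
    show "s k \<le> \<bar>left_end n c (u @ [i]) - left_end n c (u @ [j])\<bar>"
      if "i \<in> ?I" "j \<in> ?I" "i \<noteq> j" for i j
      using left_end_siblings[OF that(3)] words_length[OF u] by simp
  qed (use assms s_pos[of k] L_pos[of "Suc k"] in auto)
  also have "x + 2 * r - (x - 2 * r - L (Suc k)) \<le> (4 * real m + 9) * s k"
    using assms(3) L_less_s[of k] by (simp add: algebra_simps)
  then have "(x + 2 * r - (x - 2 * r - L (Suc k))) / s k + 1 \<le> 4 * real m + 10"
    using s_pos[of k] by (simp add: pos_divide_le_eq add.commute)
  finally show ?thesis by linarith
qed

lemma card_meeting_ball:
  assumes "0 < r" "r \<le> L k" "r - L (Suc k) \<le> (real m + 1) * s k"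
  shows "card {w \<in> words n (Suc k). J w \<inter> ball x (2 * r) \<noteq> {}} \<le> 60 * (m + 1)"
proof -
  let ?B = "ball x (2 * r)"
  let ?U = "{u \<in> words n k. J u \<inter> ?B \<noteq> {}}"
  let ?I = "\<lambda>u. {i \<in> {1..n (Suc k)}. J (u @ [i]) \<inter> ?B \<noteq> {}}"
  let ?S = "SIGMA u:?U. ?I u"
  have "finite ?U" by (simp add: finite_words)
  have "{w \<in> words n (Suc k). J w \<inter> ?B \<noteq> {}} \<subseteq> (\<lambda>(u, i). u @ [i]) ` ?S"
  proof
    fix w assume "w \<in> {w \<in> words n (Suc k). J w \<inter> ?B \<noteq> {}}"
    then have w: "w \<in> words n (Suc k)" "J w \<inter> ?B \<noteq> {}" by auto
    obtain u i where ui: "w = u @ [i]" "u \<in> words n k" "i \<in> {1..n (Suc k)}"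
      using w(1) by (rule words_SucE)
    have "J u \<inter> ?B \<noteq> {}" using w(2) child_subset[OF ui(2,3)] ui(1) by blast
    then have "(u, i) \<in> ?S" using ui w(2) by simp
    then show "w \<in> (\<lambda>(u, i). u @ [i]) ` ?S" using ui(1) by force
  qed
  then have "card {w \<in> words n (Suc k). J w \<inter> ?B \<noteq> {}} \<le> card ?S"
    using \<open>finite ?U\<close> by (intro surj_card_le[of ?S]) auto
  also have "\<dots> = (\<Sum>u\<in>?U. card (?I u))"
    using \<open>finite ?U\<close> by (intro card_SigmaI) auto
  also have "\<dots> \<le> of_nat (card ?U) * (4 * m + 10)"
    using card_children_meeting_ball[OF _ assms(1,3)] by (intro sum_bounded_above) auto
  also have "\<dots> \<le> 6 * (4 * m + 10)"
    using card_parents_meeting_ball[OF assms(1,2), of x] by (intro mult_right_mono) auto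
  also have "\<dots> \<le> 60 * (m + 1)" by simp
  finally show ?thesis .
qed

section \<open>Comparable masses give doubling\<close>

text \<open>All masses are compared with that of the component \<open>w\<close> of level \<open>k + 1\<close> around the centre: the
  double of the ball has at most \<open>60 (m + 1) A\<close> times this mass, the ball at least \<open>(m + 1) / A\<close> times.\<close>

lemma doubling_on_if_masses_comparable:
  fixes \<mu> :: "real measure" and A :: real
  defines "M w \<equiv> measure \<mu> (J w \<inter> E)"
  assumes "prob_space \<mu>" and space: "space \<mu> = E" and sets: "sets \<mu> = sets (restrict_space borel E)"
    and pos: "\<And>k w. w \<in> words n k \<Longrightarrow> 0 < M w"
    and comparable: "\<And>k v w. v \<in> words n k \<Longrightarrow> w \<in> words n k \<Longrightarrow> M v \<le> A * M w"
  shows "doubling_on E \<mu>"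
proof -
  interpret prob_space \<mu> by fact
  have "M [] \<le> A * M []" "0 < M []" using comparable[of "[]" 0] pos[of "[]" 0] by (auto simp: words_0)
  then have "1 \<le> A" by simp
  have measurable: "S \<inter> E \<in> sets \<mu>" if "S \<in> sets borel" for S
    unfolding sets sets_restrict_space using that by auto
  have measurable_J: "J w \<inter> E \<in> sets \<mu>" for w
    by (intro measurable) (simp add: word_interval_def)
  have measurable_ball: "ball x r \<inter> E \<in> sets \<mu>" for x r
    by (intro measurable) simp
  have small_balls: "0 < measure \<mu> (ball x r \<inter> E) \<and>
      measure \<mu> (ball x (2 * r) \<inter> E) \<le> 60 * A\<^sup>2 * measure \<mu> (ball x r \<inter> E)"
    if x: "x \<in> E" and r: "0 < r" "r \<le> 1" for x r
  proof -
    obtain k where k: "L (Suc k) < r" "r \<le> L k" using find_scale[OF r] by blast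
    obtain m where m: "real m * s k < r - L (Suc k)" "r - L (Suc k) \<le> (real m + 1) * s k"
      using find_multiple[OF k(1)] by blast
    obtain w where w: "w \<in> words n (Suc k)" "x \<in> J w" using x E_subset[of "Suc k"] by blast
    obtain u i where ui: "w = u @ [i]" "u \<in> words n k" "i \<in> {1..n (Suc k)}"
      using w(1) by (rule words_SucE)
    let ?H = "{v \<in> words n (Suc k). J v \<inter> ball x (2 * r) \<noteq> {}}"
    let ?T = "{j \<in> {1..n (Suc k)}. \<bar>real j - real i\<bar> \<le> real m}"
    have "measure \<mu> (ball x (2 * r) \<inter> E) \<le> measure \<mu> (\<Union>v\<in>?H. J v \<inter> E)"
    proof (rule finite_measure_mono)
      show "ball x (2 * r) \<inter> E \<subseteq> (\<Union>v\<in>?H. J v \<inter> E)" using E_subset[of "Suc k"] by blast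
      show "(\<Union>v\<in>?H. J v \<inter> E) \<in> sets \<mu>"
        using measurable_J by (intro sets.finite_UN) (auto simp: finite_words)
    qed
    also have "\<dots> \<le> (\<Sum>v\<in>?H. M v)"
      unfolding M_def using measurable_J
      by (intro finite_measure_subadditive_finite) (auto simp: finite_words)
    also have "\<dots> \<le> of_nat (card ?H) * (A * M w)"
      using comparable w(1) by (intro sum_bounded_above) auto
    also have "\<dots> \<le> real (60 * (m + 1)) * (A * M w)"
      using card_meeting_ball[OF r(1) k(2) m(2), of x] \<open>1 \<le> A\<close> pos[OF w(1)]
      by (intro mult_right_mono of_nat_mono) auto
    finally have upper: "measure \<mu> (ball x (2 * r) \<inter> E) \<le> 60 * A * ((real m + 1) * M w)"
      by (simp add: algebra_simps)
    \<comment> \<open>as \<open>r \<le> L k\<close>, the multiple \<open>m\<close> stays below the number of children\<close>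
    have "real m * s k < (real (n (Suc k)) - 1) * s k"
      using m(1) k(2) L_decompose[of k] by linarith
    then have "m < n (Suc k)" using s_pos[of k] by simp
    have "(real m + 1) * M w \<le> real (card ?T) * M w"
      using card_neighbours[OF ui(3) \<open>m < n (Suc k)\<close>] pos[OF w(1)]
      by (intro mult_right_mono) auto
    also have "\<dots> \<le> (\<Sum>j\<in>?T. A * M (u @ [j]))"
      using comparable[OF w(1)] ui(2) by (intro sum_bounded_below) (auto simp: words_snoc_iff)
    also have "\<dots> = A * (\<Sum>j\<in>?T. measure \<mu> (J (u @ [j]) \<inter> E))"
      by (simp add: sum_distrib_left M_def)
    also have "(\<Sum>j\<in>?T. measure \<mu> (J (u @ [j]) \<inter> E)) = measure \<mu> (\<Union>j\<in>?T. J (u @ [j]) \<inter> E)"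
    proof (rule finite_measure_finite_Union[symmetric])
      show "disjoint_family_on (\<lambda>j. J (u @ [j]) \<inter> E) ?T"
        unfolding disjoint_family_on_def
      proof (intro ballI impI)
        fix i j assume "i \<in> ?T" "j \<in> ?T" "i \<noteq> j"
        then have "J (u @ [i]) \<inter> J (u @ [j]) = {}"
          using ui(2) by (intro word_intervals_disjoint[of _ "Suc k"]) (auto simp: words_snoc_iff)
        then show "J (u @ [i]) \<inter> E \<inter> (J (u @ [j]) \<inter> E) = {}" by blast
      qed
    qed (use measurable_J in auto)
    also have "\<dots> \<le> measure \<mu> (ball x r \<inter> E)"
    proof (rule finite_measure_mono[OF _ measurable_ball])
      show "(\<Union>j\<in>?T. J (u @ [j]) \<inter> E) \<subseteq> ball x r \<inter> E"
        using sibling_in_ball[OF ui(2) _ _ m(1)] w(2) ui(1) by blast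
    qed
    finally have lower: "(real m + 1) * M w \<le> A * measure \<mu> (ball x r \<inter> E)"
      using \<open>1 \<le> A\<close> by simp
    have "0 < (real m + 1) * M w" using pos[OF w(1)] by simp
    then have "0 < measure \<mu> (ball x r \<inter> E)"
      using lower \<open>1 \<le> A\<close> by (smt (verit) zero_less_mult_pos)
    moreover have "60 * A * ((real m + 1) * M w) \<le> 60 * A * (A * measure \<mu> (ball x r \<inter> E))"
      using lower \<open>1 \<le> A\<close> by (intro mult_left_mono) auto
    ultimately show ?thesis using upper by (simp add: power2_eq_square algebra_simps)
  qed
  have large_balls: "ball x r \<inter> E = E" if "x \<in> E" "1 < r" for x r
  proof -
    have "x \<in> {0..1}" "E \<subseteq> {0..1}" using that(1) E_subset_unit by (auto simp: word_interval_def)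
    then have "E \<subseteq> ball x r" using that(2) by (force simp: dist_real_def)
    then show ?thesis by blast
  qed
  have total: "measure \<mu> E = 1" using prob_space space by simp
  have "1 \<le> 60 * A\<^sup>2" using one_le_power[OF \<open>1 \<le> A\<close>, of 2] by simp
  have balls: "0 < measure \<mu> (ball x r \<inter> E) \<and>
      measure \<mu> (ball x (2 * r) \<inter> E) \<le> 60 * A\<^sup>2 * measure \<mu> (ball x r \<inter> E)"
    if "x \<in> E" "0 < r" for x r
  proof (cases "r \<le> 1")
    case True
    then show ?thesis using small_balls that by blast
  next
    case False
    then show ?thesis
      using large_balls[of x r] large_balls[of x "2 * r"] that total \<open>1 \<le> 60 * A\<^sup>2\<close> by simp
  qed
  have "borel_regular_on E \<mu>"
    unfolding borel_regular_on_def
  proof (intro conjI allI impI)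
    fix S assume "S \<subseteq> E"
    \<comment> \<open>measurable hulls exist, and every measurable set is relatively Borel\<close>
    then obtain B where "B \<in> sets \<mu>" "S \<subseteq> B" "outer_measure_of \<mu> S = emeasure \<mu> B"
      using outer_measure_of_attain[of S \<mu>] space by blast
    then show "\<exists>B\<in>sets (restrict_space borel E).
        S \<subseteq> B \<and> outer_measure_of \<mu> S = outer_measure_of \<mu> B"
      using sets by auto
  qed (use space sets in auto)
  moreover have "0 < emeasure \<mu> (ball x (2 * r) \<inter> E) \<and>
      emeasure \<mu> (ball x (2 * r) \<inter> E) \<le> ennreal (60 * A\<^sup>2) * emeasure \<mu> (ball x r \<inter> E) \<and>
      ennreal (60 * A\<^sup>2) * emeasure \<mu> (ball x r \<inter> E) < \<infinity>" if "x \<in> E" "0 < r" for x r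
    using balls[OF that] balls[of x "2 * r"] that \<open>1 \<le> 60 * A\<^sup>2\<close>
    by (simp add: emeasure_eq_measure ennreal_mult'[symmetric] ennreal_mult_less_top)
  ultimately show ?thesis
    unfolding doubling_on_def using \<open>1 \<le> 60 * A\<^sup>2\<close> by blast
qed

end

section \<open>Masses of an ultimately 1-uniform sequence\<close>

text \<open>Comparing the windows of length \<open>1\<close> at neighbouring positions bounds the ratio of neighbouring
  entries by \<open>1\<close> on both sides.\<close>

lemma uniform_vector_1_entries:
  assumes "uniform_vector 1 p" "positive_prob_vector p" "i < length p"
  shows "p ! i = 1 / real (length p)"
proof -
  have pos: "0 < p ! j" if "j < length p" for j
    using assms(2) that by (simp add: positive_prob_vector_def)
  have step: "p ! Suc j = p ! j" if "Suc j < length p" for j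
  proof -
    have "1 \<le> p ! j / p ! Suc j \<and> p ! j / p ! Suc j \<le> 1"
      using assms(1)[unfolded uniform_vector_def, rule_format, of 1 j "Suc j"] that by simp
    then show ?thesis using pos[OF that] by (simp add: field_simps)
  qed
  have const: "p ! j = p ! 0" if "j < length p" for j
    using that by (induction j) (auto simp: step)
  have "1 = (\<Sum>j<length p. p ! j)"
    using assms(2) by (simp add: positive_prob_vector_def sum_list_sum_nth atLeast0LessThan)
  also have "\<dots> = (\<Sum>j<length p. p ! i)"
    using const assms(3) by (intro sum.cong) auto
  finally have "real (length p) * p ! i = 1" by simp
  moreover have "real (length p) \<noteq> 0" using assms(3) by auto
  ultimately show ?thesis by (simp add: nonzero_eq_divide_eq mult.commute)
qed

theorem corollary3:
  fixes n :: "nat \<Rightarrow> nat" and c :: "nat \<Rightarrow> real"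
    and P :: "nat \<Rightarrow> real list" and \<mu> :: "real measure"
  assumes "uniform_cantor_data n c"
    and "matching n P"
    and "\<And>k. k \<ge> 1 \<Longrightarrow> positive_prob_vector (P k)"
    and "is_cantor_measure n c P \<mu>"
    and "ultimately_uniform 1 P"
  shows "doubling_on (uniform_cantor_set n c) \<mu>"
proof -
  interpret uniform_cantor n c by standard (rule assms(1))
  have \<mu>: "prob_space \<mu>" "space \<mu> = E" "sets \<mu> = sets (restrict_space borel E)"
    using assms(4) by (simp_all add: is_cantor_measure_def)
  interpret prob_space \<mu> by fact
  define M where "M w = measure \<mu> (J w \<inter> E)" for w
  have M_snoc: "M (w @ [i]) = P (Suc k) ! (i - 1) * M w"
    if "w \<in> words n k" "i \<in> {1..n (Suc k)}" for k w i
  proof -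
    have "measure \<mu> (cantor_interval n c (w @ [i]) \<inter> E) =
        P (Suc k) ! (i - 1) * measure \<mu> (cantor_interval n c w \<inter> E)"
      using assms(4)[unfolded is_cantor_measure_def] that
      by (metis One_nat_def diff_Suc_1 le_add1 plus_1_eq_Suc)
    moreover have "w @ [i] \<in> words n (Suc k)" using that by (simp add: words_snoc_iff)
    ultimately show ?thesis using cantor_interval_eq that(1) by (simp add: M_def)
  qed
  have len: "length (P (Suc k)) = n (Suc k)" for k using assms(2) by (simp add: matching_def)
  have M_pos: "0 < M w" if "w \<in> words n k" for k w
    using that
  proof (induction k arbitrary: w)
    case 0
    then have "M w = 1"
      using E_subset_unit prob_space \<mu>(2) by (simp add: words_0 M_def Int_absorb1)
    then show ?case by simp
  next
    case (Suc k)
    obtain u i where w: "w = u @ [i]" "u \<in> words n k" "i \<in> {1..n (Suc k)}"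
      using Suc.prems by (rule words_SucE)
    have "0 < P (Suc k) ! (i - 1)"
      using assms(3)[of "Suc k"] len[of k] w(3) by (auto simp: positive_prob_vector_def)
    then show ?case using Suc.IH[OF w(2)] M_snoc[OF w(2,3)] w(1) by simp
  qed
  obtain K where K: "\<And>k. K \<le> k \<Longrightarrow> uniform_vector 1 (P k)"
    using assms(5) by (auto simp: ultimately_uniform_def)
  have M_equal: "M (w @ [i]) = M w / real (n (Suc k))"
    if "K \<le> k" "w \<in> words n k" "i \<in> {1..n (Suc k)}" for k w i
  proof -
    have "P (Suc k) ! (i - 1) = 1 / real (n (Suc k))"
      using uniform_vector_1_entries[OF K assms(3)] that len[of k] by auto
    then show ?thesis using M_snoc[OF that(2,3)] by simp
  qed
  \<comment> \<open>\<open>Min D\<close> bounds from below the masses before equal division sets in; \<open>1\<close> makes \<open>D\<close> visibly nonempty\<close>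
  define D where "D = insert 1 (M ` (\<Union>k\<le>K. words n k))"
  have "finite D" "D \<noteq> {}" by (simp_all add: D_def finite_words)
  have D_pos: "0 < Min D"
    using M_pos by (subst Min_gr_iff[OF \<open>finite D\<close> \<open>D \<noteq> {}\<close>]) (auto simp: D_def)
  have comparable_early: "M v \<le> 1 / Min D * M w" if "k \<le> K" "w \<in> words n k" for k v w
  proof -
    have "Min D \<le> M w" using that \<open>finite D\<close> by (intro Min_le) (auto simp: D_def)
    moreover have "M v \<le> 1" by (simp add: M_def)
    moreover have "M v * Min D \<le> 1 * Min D"
      using \<open>M v \<le> 1\<close> less_imp_le[OF D_pos] by (rule mult_right_mono)
    ultimately have "M v * Min D \<le> M w" by linarith
    then show ?thesis using D_pos by (simp add: field_simps)
  qed
  have comparable: "M v \<le> 1 / Min D * M w" if "v \<in> words n k" "w \<in> words n k" for k v w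
  proof (cases "k \<le> K")
    case True
    then show ?thesis using comparable_early that by blast
  next
    case False
    then have "K \<le> k" by simp
    then show ?thesis using that
    proof (induction k arbitrary: v w rule: dec_induct)
      case base
      then show ?case using comparable_early by blast
    next
      case (step k)
      obtain v' i where v: "v = v' @ [i]" "v' \<in> words n k" "i \<in> {1..n (Suc k)}"
        using step.prems(1) by (rule words_SucE)
      obtain w' j where w: "w = w' @ [j]" "w' \<in> words n k" "j \<in> {1..n (Suc k)}"
        using step.prems(2) by (rule words_SucE)
      have "M v' / real (n (Suc k)) \<le> (1 / Min D * M w') / real (n (Suc k))"
        using step.IH[OF v(2) w(2)] by (intro divide_right_mono) auto
      then show ?case using M_equal[OF step.hyps(1)] v w by simp
    qed
  qed
  show ?thesis
  proof (rule doubling_on_if_masses_comparable[OF \<mu>])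
    show "0 < measure \<mu> (J w \<inter> E)" if "w \<in> words n k" for w k
      using M_pos[OF that] by (simp add: M_def)
    show "measure \<mu> (J v \<inter> E) \<le> 1 / Min D * measure \<mu> (J w \<inter> E)"
      if "v \<in> words n k" "w \<in> words n k" for k v w
      using comparable[OF that] by (simp add: M_def)
  qed
qed

end
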